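(* Let the GADI-IR algorithm (described in the context) be applied to the linear system $Ax=b$, where $A\in\mathbb{R}^{n\times n}$ is nonsingular and $x$ is the exact solution, and assume that the solver used for the two inner systems (with matrices $H$ and $S$) is backward stable. Then for every $k\ge 0$ the computed iterate $\hat x_{k+1}$ satisfies $$\|x-\hat x_{k+1}\|\le \alpha_F\,\|x-\hat x_k\|+\beta_F\,\|x\|,$$ where $$\alpha_F=\lambda+(2-\omega)\theta\hat\kappa(HS)+\varphi_2(n)u+4(2-\omega)\varphi_2(n)\hat\kappa(HS)\,u(1+u_r)(1+u_f)+4(2-\omega)\hat\kappa(HS)u_r+4(2-\omega)(1+u_r)u_f\hat\kappa(HS),$$ $$\beta_F=\varphi_2(n)u+4(2-\omega)\varphi_2(n)\hat\kappa(HS)\,u(1+u_r)u_f+8(2-\omega)(1+u_r)u_f\hat\kappa(HS),$$ and $$\hat\kappa(HS)=\kappa(H)\kappa(S)\,\frac{\alpha\|H\|+\alpha\|S\|+2\alpha^2}{\|H\|\,\|S\|}.$$ Here $\theta$ and $\varphi_2(n)$ are the quantities defined in the context, and $\lambda<1$ is a number, whose existence is derived from $\rho(T(\alpha,\omega))<1$, such that $\|T(\alpha,\omega)(x-\hat x_k)\|\le\lambda\|x-\hat x_k\|$, with $T(\alpha,\omega)$ the iteration matrix defined in the context.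
   Context: $\|\cdot\|$ is a vector norm and the induced operator norm on matrices; $\kappa(B)=\|B\|\,\|B^{-1}\|$ for nonsingular $B$; $\rho$ is the spectral radius. Splitting: $M,N\in\mathbb{C}^{n\times n}$ with $A=M+N$; $\alpha>0$, $\omega\in[0,2)$; $H=\alpha I+M$, $S=\alpha I+N$; $p=(2-\omega)\alpha$. GADI-IR algorithm (from a starting vector $\hat x_0$), at step $k$: compute the residual $\hat r_k\approx b-A\hat x_k$ (precision $u_f$, then rounded to precision $u_r$); solve $H\hat z_k\approx \hat r_k$ (precision $u_r$); solve $S\hat y_k\approx p\,\hat z_k$ (precision $u_r$); set $\hat x_{k+1}\approx\hat x_k+\hat y_k$ (precision $u$). Floating-point error model: for every $k\ge0$, $$\hat r_k=b-A\hat x_k+\Delta\hat r_k,\quad \|\Delta\hat r_k\|\le u_r\|b-A\hat x_k\|+(1+u_r)u_f(\|A\|\|\hat x_k\|+\|b\|),$$ $$\hat x_{k+1}=\hat x_k+\hat y_k+\Delta\hat x_k,\quad \|\Delta\hat x_k\|\le\varphi_2(n)\,u\,(\|\hat x_k\|+\|\hat y_k\|),$$ with $\varphi_2(n)$ depending only on $n$. Backward stability of the inner solver means that there are matrices $G_k,F_k$ with $$(H+G_k)\hat z_k=\hat r_k,\qquad (S+F_k)\hat y_k=p\,\hat z_k,\qquad \|G_k\|\le\phi(n)u_r\|M\|,\quad \|F_k\|\le\varphi(n)u_r\|N\|,$$ where $\phi(n),\varphi(n)$ are reasonably small functions of $n$. The precision $u_r$ is small enough (a fixed small function of $n$ times $\kappa(S)u_r$,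 respectively $\kappa(H)u_r$, is less than $1/2$) that $H+G_k$ and $S+F_k$ are nonsingular and $$(S+F_k)^{-1}=(I+J_k)S^{-1},\quad (H+G_k)^{-1}=(I+L_k)H^{-1},\quad \|J_k\|<1,\ \|L_k\|<1.$$ Set $\theta=\|J_k\|+\|L_k\|+\|J_k\|\|L_k\|$. GADI iteration matrix: $T(\alpha,\omega)=(\alpha I+N)^{-1}(\alpha I+M)^{-1}\big(\alpha^2I+MN-(1-\omega)\alpha A\big)$. The quoted convergence theorem for the GADI framework (Jiang et al., 2022) states that $\rho(T(\alpha,\omega))<1$ for any $\alpha>0$ and $\omega\in[0,2)$.
   Formalization: The number λ<1 with ‖T(α,ω)(x−x̂_k)‖ ≤ λ‖x−x̂_k‖ is assumed to exist at the step considered rather than derived from ρ(T(α,ω))<1, since for a fixed norm ρ(T)<1 does not imply that such a λ exists. *)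

theory Defs
  imports "HOL-Analysis.Analysis"
begin

definition vector_norm :: "(complex^'n \<Rightarrow> real) \<Rightarrow> bool" where
  "vector_norm \<nu> \<longleftrightarrow>
     (\<forall>v. 0 \<le> \<nu> v) \<and> (\<forall>v. \<nu> v = 0 \<longleftrightarrow> v = 0) \<and>
     (\<forall>c v. \<nu> (c *s v) = cmod c * \<nu> v) \<and>
     (\<forall>v w. \<nu> (v + w) \<le> \<nu> v + \<nu> w)"

definition op_norm :: "(complex^'n \<Rightarrow> real) \<Rightarrow> complex^'n^'n \<Rightarrow> real" where
  "op_norm \<nu> B = (SUP v\<in>{v. v \<noteq> 0}. \<nu> (B *v v) / \<nu> v)"

definition cond_num :: "(complex^'n \<Rightarrow> real) \<Rightarrow> complex^'n^'n \<Rightarrow> real" where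
  "cond_num \<nu> B = op_norm \<nu> B * op_norm \<nu> (matrix_inv B)"

definition spectral_radius :: "complex^'n^'n \<Rightarrow> real" where
  "spectral_radius B = Sup {cmod \<mu> | \<mu>. \<exists>v. v \<noteq> 0 \<and> B *v v = \<mu> *s v}"

text \<open>The matrix \<open>\<alpha> I + B\<close>; thus \<open>H = shifted \<alpha> M\<close> and \<open>S = shifted \<alpha> N\<close>.\<close>

definition shifted :: "real \<Rightarrow> complex^'n^'n \<Rightarrow> complex^'n^'n" where
  "shifted \<alpha> B = \<alpha> *\<^sub>R mat 1 + B"

definition gadi_T :: "complex^'n^'n \<Rightarrow> complex^'n^'n \<Rightarrow> real \<Rightarrow> real \<Rightarrow> complex^'n^'n" where
  "gadi_T M N \<alpha> \<omega> =
     matrix_inv (shifted \<alpha> N) ** matrix_inv (shifted \<alpha> M) **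
     (\<alpha>\<^sup>2 *\<^sub>R mat 1 + M ** N - ((1 - \<omega>) * \<alpha>) *\<^sub>R (M + N))"

text \<open>Convergence of the GADI framework for the splitting \<open>M + N\<close>. The nonsingularity
  requirements say that the iteration matrix is well defined; \<open>matrix_inv\<close> is unspecified on
  singular matrices.\<close>

definition gadi_convergent :: "complex^'n^'n \<Rightarrow> complex^'n^'n \<Rightarrow> bool" where
  "gadi_convergent M N \<longleftrightarrow>
     (\<forall>\<alpha> \<omega>. 0 < \<alpha> \<and> 0 \<le> \<omega> \<and> \<omega> < 2 \<longrightarrow>
        invertible (shifted \<alpha> M) \<and> invertible (shifted \<alpha> N) \<and>
        spectral_radius (gadi_T M N \<alpha> \<omega>) < 1)"

text \<open>Rounding-error model of the outer loop: computed iterates \<open>xh\<close>, residuals \<open>rh\<close> and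
  updates \<open>yh\<close>; \<open>f2\<close> is the value \<open>\<phi>\<^sub>2(n)\<close>.\<close>

definition rounded_iteration ::
  "(complex^'n \<Rightarrow> real) \<Rightarrow> real \<Rightarrow> real \<Rightarrow> real \<Rightarrow> real \<Rightarrow> complex^'n^'n \<Rightarrow> complex^'n \<Rightarrow>
   (nat \<Rightarrow> complex^'n) \<Rightarrow> (nat \<Rightarrow> complex^'n) \<Rightarrow> (nat \<Rightarrow> complex^'n) \<Rightarrow> bool" where
  "rounded_iteration \<nu> f2 u u\<^sub>r u\<^sub>f A b xh rh yh \<longleftrightarrow>
     (\<forall>k. \<exists>\<Delta>r \<Delta>x.
        rh k = b - A *v xh k + \<Delta>r \<and>
        \<nu> \<Delta>r \<le> u\<^sub>r * \<nu> (b - A *v xh k) + (1 + u\<^sub>r) * u\<^sub>f * (op_norm \<nu> A * \<nu> (xh k) + \<nu> b) \<and>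
        xh (Suc k) = xh k + yh k + \<Delta>x \<and>
        \<nu> \<Delta>x \<le> f2 * u * (\<nu> (xh k) + \<nu> (yh k)))"

text \<open>Backward stability of the two inner solves, with backward errors \<open>G k\<close> and \<open>F k\<close>;
  \<open>fH\<close> and \<open>fS\<close> are the values of the two growth functions at \<open>n\<close>.\<close>

definition backward_stable_solves ::
  "(complex^'n \<Rightarrow> real) \<Rightarrow> real \<Rightarrow> real \<Rightarrow> real \<Rightarrow> complex^'n^'n \<Rightarrow> complex^'n^'n \<Rightarrow> real \<Rightarrow> real \<Rightarrow>
   (nat \<Rightarrow> complex^'n) \<Rightarrow> (nat \<Rightarrow> complex^'n) \<Rightarrow> (nat \<Rightarrow> complex^'n) \<Rightarrow>
   (nat \<Rightarrow> complex^'n^'n) \<Rightarrow> (nat \<Rightarrow> complex^'n^'n) \<Rightarrow> bool" where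
  "backward_stable_solves \<nu> fH fS u\<^sub>r M N \<alpha> \<omega> rh zh yh G F \<longleftrightarrow>
     (\<forall>k. (shifted \<alpha> M + G k) *v zh k = rh k \<and>
          (shifted \<alpha> N + F k) *v yh k = ((2 - \<omega>) * \<alpha>) *\<^sub>R zh k \<and>
          op_norm \<nu> (G k) \<le> fH * u\<^sub>r * op_norm \<nu> M \<and>
          op_norm \<nu> (F k) \<le> fS * u\<^sub>r * op_norm \<nu> N)"

definition perturbed_inverses ::
  "(complex^'n \<Rightarrow> real) \<Rightarrow> complex^'n^'n \<Rightarrow> complex^'n^'n \<Rightarrow>
   (nat \<Rightarrow> complex^'n^'n) \<Rightarrow> (nat \<Rightarrow> complex^'n^'n) \<Rightarrow>
   (nat \<Rightarrow> complex^'n^'n) \<Rightarrow> (nat \<Rightarrow> complex^'n^'n) \<Rightarrow> bool" where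
  "perturbed_inverses \<nu> H S G F J L \<longleftrightarrow>
     (\<forall>k. invertible (H + G k) \<and> invertible (S + F k) \<and>
          matrix_inv (S + F k) = (mat 1 + J k) ** matrix_inv S \<and>
          matrix_inv (H + G k) = (mat 1 + L k) ** matrix_inv H \<and>
          op_norm \<nu> (J k) < 1 \<and> op_norm \<nu> (L k) < 1)"

definition theta :: "(complex^'n \<Rightarrow> real) \<Rightarrow> complex^'n^'n \<Rightarrow> complex^'n^'n \<Rightarrow> real" where
  "theta \<nu> J L = op_norm \<nu> J + op_norm \<nu> L + op_norm \<nu> J * op_norm \<nu> L"

definition kappa_hat :: "(complex^'n \<Rightarrow> real) \<Rightarrow> real \<Rightarrow> complex^'n^'n \<Rightarrow> complex^'n^'n \<Rightarrow> real" where
  "kappa_hat \<nu> \<alpha> H S =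
     cond_num \<nu> H * cond_num \<nu> S *
     ((\<alpha> * op_norm \<nu> H + \<alpha> * op_norm \<nu> S + 2 * \<alpha>\<^sup>2) / (op_norm \<nu> H * op_norm \<nu> S))"

text \<open>In the two coefficients below \<open>\<kappa>\<close> is \<open>kappa_hat\<close>, \<open>\<theta>\<close> is \<open>theta\<close> and \<open>f2\<close> is \<open>\<phi>\<^sub>2(n)\<close>.\<close>

definition alpha_F :: "real \<Rightarrow> real \<Rightarrow> real \<Rightarrow> real \<Rightarrow> real \<Rightarrow> real \<Rightarrow> real \<Rightarrow> real \<Rightarrow> real" where
  "alpha_F lam \<omega> \<theta> \<kappa> f2 u u\<^sub>r u\<^sub>f =
     lam + (2 - \<omega>) * \<theta> * \<kappa> + f2 * u
     + 4 * (2 - \<omega>) * f2 * \<kappa> * u * (1 + u\<^sub>r) * (1 + u\<^sub>f)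
     + 4 * (2 - \<omega>) * \<kappa> * u\<^sub>r
     + 4 * (2 - \<omega>) * (1 + u\<^sub>r) * u\<^sub>f * \<kappa>"

definition beta_F :: "real \<Rightarrow> real \<Rightarrow> real \<Rightarrow> real \<Rightarrow> real \<Rightarrow> real \<Rightarrow> real" where
  "beta_F \<omega> \<kappa> f2 u u\<^sub>r u\<^sub>f =
     f2 * u
     + 4 * (2 - \<omega>) * f2 * \<kappa> * u * (1 + u\<^sub>r) * u\<^sub>f
     + 8 * (2 - \<omega>) * (1 + u\<^sub>r) * u\<^sub>f * \<kappa>"

end

theory Submission
  imports Defs "HOL-Computational_Algebra.Fundamental_Theorem_Algebra"
begin

text \<open>Since \<open>T = I - p S\<^sup>-\<^sup>1 H\<^sup>-\<^sup>1 A\<close> with \<open>p = (2 - \<omega>) \<alpha>\<close>, the new error is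
  \<open>T e - p D A e - p Q \<Delta>r - \<Delta>x\<close>, where \<open>Q = (I + J) S\<^sup>-\<^sup>1 (I + L) H\<^sup>-\<^sup>1\<close> and
  \<open>D = Q - S\<^sup>-\<^sup>1 H\<^sup>-\<^sup>1\<close>, and \<open>A = H + S - 2 \<alpha> I\<close> bounds \<open>p \<parallel>S\<^sup>-\<^sup>1\<parallel> \<parallel>H\<^sup>-\<^sup>1\<parallel> \<parallel>A\<parallel>\<close> by
  \<open>(2 - \<omega>) \<kappa>\<close>.

  The estimate \<open>(1 + \<parallel>J\<parallel>) (1 + \<parallel>L\<parallel>) \<le> 4\<close> would double the coefficient
  \<open>4 (2 - \<omega>) \<phi>\<^sub>2 \<kappa> u (1 + u\<^sub>r) u\<^sub>f\<close> of \<open>\<parallel>x\<parallel>\<close>, so more is needed. The condition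
  \<open>\<rho>(T(\<alpha>, 0)) < 1\<close> excludes that \<open>\<parallel>H\<parallel>\<close> and \<open>\<parallel>S\<parallel>\<close> are both less than \<open>\<alpha>\<close>. If
  \<open>\<alpha> \<le> \<parallel>H\<parallel>\<close> then \<open>\<parallel>M\<parallel> \<le> 2 \<parallel>H\<parallel>\<close>, hence \<open>\<parallel>L\<parallel>\<close> is at most a multiple of \<open>\<kappa>(H) u\<^sub>r\<close>;
  likewise \<open>\<parallel>J\<parallel>\<close> and \<open>\<kappa>(S) u\<^sub>r\<close> if \<open>\<alpha> \<le> \<parallel>S\<parallel>\<close>. As these products are small, one of
  the factors \<open>1 + \<parallel>J\<parallel>\<close>, \<open>1 + \<parallel>L\<parallel>\<close> is close to 1, which regains the factor 2.\<close>

section \<open>Algebra of matrices acting on complex vectors\<close>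

lemma scaleR_eq_scalar_mult:
  fixes v :: "complex^'n"
  shows "c *\<^sub>R v = complex_of_real c *s v"
  by (simp add: vec_eq_iff flip: scaleR_conv_of_real)

lemma scaleR_matrix_vector:
  fixes B :: "complex^'n^'n"
  shows "(c *\<^sub>R B) *v v = c *\<^sub>R (B *v v)"
  by (simp add: vec_eq_iff matrix_vector_mult_def scaleR_sum_right)

lemma matrix_vector_scaleR:
  fixes B :: "complex^'n^'n"
  shows "B *v (c *\<^sub>R v) = c *\<^sub>R (B *v v)"
  by (simp add: vec_eq_iff matrix_vector_mult_def scaleR_sum_right)

lemma matrix_vector_scalar:
  fixes B :: "complex^'n^'n"
  shows "B *v (c *s v) = c *s (B *v v)"
  by (simp add: vec_eq_iff matrix_vector_mult_def sum_distrib_left mult_ac)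

lemma matrix_vector_sum:
  fixes B :: "complex^'n^'n"
  shows "B *v (\<Sum>i\<in>I. f i) = (\<Sum>i\<in>I. B *v f i)"
  by (induction I rule: infinite_finite_induct) (simp_all add: matrix_vector_right_distrib)

lemmas matrix_vector_simps =
  scaleR_matrix_vector matrix_vector_scaleR matrix_vector_right_distrib
  matrix_vector_mult_diff_distrib matrix_vector_mult_add_rdistrib
  matrix_vector_mult_diff_rdistrib matrix_vector_mul_assoc[symmetric]

lemma matrix_inv_vector:
  fixes B :: "complex^'n^'n"
  assumes "invertible B"
  shows "B *v (matrix_inv B *v v) = v" "matrix_inv B *v (B *v v) = v"
proof -
  have "B ** matrix_inv B = mat 1 \<and> matrix_inv B ** B = mat 1"
    unfolding matrix_inv_def using assms unfolding invertible_def by (rule someI_ex)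
  then show "B *v (matrix_inv B *v v) = v" "matrix_inv B *v (B *v v) = v"
    by (simp_all add: matrix_vector_mul_assoc)
qed

lemma shifted_vector: "shifted \<alpha> B *v v = \<alpha> *\<^sub>R v + B *v v"
  by (simp add: shifted_def matrix_vector_simps)

subsection \<open>Vector norms and their operator norms\<close>

lemma
  assumes "vector_norm \<nu>"
  shows vector_norm_nonneg: "0 \<le> \<nu> v"
    and vector_norm_eq_0_iff: "\<nu> v = 0 \<longleftrightarrow> v = 0"
    and vector_norm_scalar: "\<nu> (c *s v) = cmod c * \<nu> v"
    and vector_norm_add: "\<nu> (v + w) \<le> \<nu> v + \<nu> w"
  using assms by (auto simp: vector_norm_def)

lemma vector_norm_scaleR: "vector_norm \<nu> \<Longrightarrow> \<nu> (c *\<^sub>R v) = \<bar>c\<bar> * \<nu> v"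
  by (simp add: scaleR_eq_scalar_mult vector_norm_scalar)

lemma vector_norm_minus: "vector_norm \<nu> \<Longrightarrow> \<nu> (- v) = \<nu> v"
  using vector_norm_scaleR[of \<nu> "-1" v] by simp

lemma vector_norm_diff: "vector_norm \<nu> \<Longrightarrow> \<nu> (v - w) \<le> \<nu> v + \<nu> w"
  using vector_norm_add[of \<nu> v "- w"] by (simp add: vector_norm_minus)

lemma vector_norm_sum:
  assumes "vector_norm \<nu>" "finite I"
  shows "\<nu> (\<Sum>i\<in>I. f i) \<le> (\<Sum>i\<in>I. \<nu> (f i))"
  using assms(2)
proof (induction I rule: finite_induct)
  case empty
  show ?case using vector_norm_eq_0_iff[OF assms(1), of 0] by simp
next
  case (insert i I)
  then show ?case using vector_norm_add[OF assms(1), of "f i" "sum f I"] by simp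
qed

text \<open>Writing \<open>B *v v\<close> as a combination of the columns of \<open>B\<close> bounds
  it by the Euclidean norm. For \<open>B = mat 1\<close> this is the upper half of norm
  equivalence.\<close>

lemma vector_norm_matrix_le_norm:
  assumes "vector_norm \<nu>"
  shows "\<nu> (B *v v) \<le> (\<Sum>i\<in>UNIV. \<nu> (column i B)) * norm v"
proof -
  have "\<nu> (B *v v) \<le> (\<Sum>i\<in>UNIV. cmod (v $ i) * \<nu> (column i B))"
    unfolding matrix_mult_sum
    using vector_norm_sum[OF assms, of UNIV "\<lambda>i. v $ i *s column i B"]
    by (simp add: vector_norm_scalar[OF assms])
  also have "\<dots> \<le> (\<Sum>i\<in>UNIV. norm v * \<nu> (column i B))"
    by (intro sum_mono mult_right_mono vector_norm_nonneg[OF assms])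
      (simp add: Finite_Cartesian_Product.norm_nth_le)
  finally show ?thesis by (simp add: sum_distrib_left mult_ac)
qed

text \<open>The lower half of norm equivalence: \<open>\<nu>\<close> is Lipschitz, hence attains a
  minimum on the compact Euclidean unit sphere. Definiteness makes this minimum positive, and
  homogeneity carries the bound from the sphere to all vectors.\<close>

lemma norm_le_vector_norm:
  fixes \<nu> :: "complex^'n \<Rightarrow> real"
  assumes nu: "vector_norm \<nu>"
  obtains m where "m > 0" "\<And>v. m * norm v \<le> \<nu> v"
proof -
  define K where "K = (\<Sum>i\<in>UNIV. \<nu> (column i (mat 1 :: complex^'n^'n)))"
  have K: "\<nu> v \<le> K * norm v" for v
    using vector_norm_matrix_le_norm[OF nu, of "mat 1" v] by (simp add: K_def)
  have "K-lipschitz_on UNIV \<nu>"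
  proof (rule lipschitz_onI)
    show "0 \<le> K" unfolding K_def by (intro sum_nonneg vector_norm_nonneg[OF nu])
    fix v w :: "complex^'n"
    have "\<nu> v \<le> \<nu> w + \<nu> (v - w)" "\<nu> w \<le> \<nu> v + \<nu> (v - w)"
      using vector_norm_add[OF nu, of w "v - w"] vector_norm_diff[OF nu, of v "v - w"] by simp_all
    then show "dist (\<nu> v) (\<nu> w) \<le> K * dist v w"
      using K[of "v - w"] by (simp add: dist_norm)
  qed
  then have "continuous_on (sphere 0 1) \<nu>"
    using continuous_on_subset lipschitz_on_continuous_on by blast
  moreover have "norm (axis undefined 1 :: complex^'n) = 1" by simp
  then have "sphere 0 1 \<noteq> ({} :: (complex^'n) set)" by (metis mem_sphere_0 empty_iff)
  ultimately obtain v0 :: "complex^'n" where v0: "norm v0 = 1" "\<And>v. norm v = 1 \<Longrightarrow> \<nu> v0 \<le> \<nu> v"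
    using continuous_attains_inf[of "sphere 0 1" \<nu>] by auto
  show thesis
  proof
    show "\<nu> v0 > 0"
      using v0(1) vector_norm_nonneg[OF nu, of v0] vector_norm_eq_0_iff[OF nu, of v0]
      by (cases "v0 = 0") (auto simp: less_le)
    fix v :: "complex^'n"
    show "\<nu> v0 * norm v \<le> \<nu> v"
    proof (cases "v = 0")
      case True
      then show ?thesis using vector_norm_nonneg[OF nu] by simp
    next
      case False
      then have "\<nu> v0 \<le> \<nu> ((1 / norm v) *\<^sub>R v)" by (intro v0(2)) simp
      also have "\<dots> = \<nu> v / norm v" by (simp add: vector_norm_scaleR[OF nu])
      finally show ?thesis using False by (simp add: field_simps)
    qed
  qed
qed

text \<open>A real supremum is meaningful only for a bounded set. The two halves of norm equivalence
  bound the quotients that define \<open>op_norm\<close>.\<close>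

lemma op_norm_bdd_above:
  fixes \<nu> :: "complex^'n \<Rightarrow> real"
  assumes nu: "vector_norm \<nu>"
  shows "bdd_above ((\<lambda>v. \<nu> (B *v v) / \<nu> v) ` {v. v \<noteq> 0})"
proof -
  obtain m where m: "m > 0" "\<And>v. m * norm v \<le> \<nu> v" using norm_le_vector_norm[OF nu] by blast
  define K where "K = (\<Sum>i\<in>UNIV. \<nu> (column i B))"
  have "K \<ge> 0" unfolding K_def by (intro sum_nonneg vector_norm_nonneg[OF nu])
  show ?thesis
  proof (rule bdd_aboveI2)
    fix v :: "complex^'n"
    assume "v \<in> {v. v \<noteq> 0}"
    then have pos: "\<nu> v > 0"
      using vector_norm_nonneg[OF nu, of v] vector_norm_eq_0_iff[OF nu, of v] by (auto simp: less_le)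
    have "\<nu> (B *v v) \<le> K * norm v" unfolding K_def by (rule vector_norm_matrix_le_norm[OF nu])
    also have "\<dots> \<le> K * (\<nu> v / m)"
      using m(2)[of v] m(1) \<open>K \<ge> 0\<close> by (intro mult_left_mono) (auto simp: field_simps)
    finally show "\<nu> (B *v v) / \<nu> v \<le> K / m" using pos m(1) by (simp add: field_simps)
  qed
qed

lemma op_norm_bound:
  assumes nu: "vector_norm \<nu>"
  shows "\<nu> (B *v v) \<le> op_norm \<nu> B * \<nu> v"
proof (cases "v = 0")
  case True
  then show ?thesis using vector_norm_eq_0_iff[OF nu, of 0] by simp
next
  case False
  then have "\<nu> (B *v v) / \<nu> v \<le> op_norm \<nu> B"
    unfolding op_norm_def by (intro cSUP_upper op_norm_bdd_above[OF nu]) simp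
  moreover have "\<nu> v > 0"
    using False vector_norm_nonneg[OF nu, of v] vector_norm_eq_0_iff[OF nu, of v] by (auto simp: less_le)
  ultimately show ?thesis by (simp add: field_simps)
qed

lemma op_norm_least:
  fixes \<nu> :: "complex^'n \<Rightarrow> real"
  assumes nu: "vector_norm \<nu>" and bound: "\<And>v. \<nu> (B *v v) \<le> C * \<nu> v"
  shows "op_norm \<nu> B \<le> C"
  unfolding op_norm_def
proof (rule cSUP_least)
  have "axis undefined 1 \<noteq> (0 :: complex^'n)" by (simp add: axis_eq_0_iff)
  then show "{v :: complex^'n. v \<noteq> 0} \<noteq> {}" by blast
  fix v :: "complex^'n"
  assume "v \<in> {v. v \<noteq> 0}"
  then have "\<nu> v > 0"
    using vector_norm_nonneg[OF nu, of v] vector_norm_eq_0_iff[OF nu, of v] by (auto simp: less_le)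
  then show "\<nu> (B *v v) / \<nu> v \<le> C" using bound[of v] by (simp add: field_simps)
qed

lemma op_norm_nonneg:
  fixes \<nu> :: "complex^'n \<Rightarrow> real"
  assumes nu: "vector_norm \<nu>"
  shows "0 \<le> op_norm \<nu> B"
proof -
  define v where "v = (axis undefined 1 :: complex^'n)"
  have "v \<noteq> 0" by (simp add: v_def axis_eq_0_iff)
  then have "\<nu> v > 0"
    using vector_norm_nonneg[OF nu, of v] vector_norm_eq_0_iff[OF nu, of v] by (auto simp: less_le)
  moreover have "0 \<le> op_norm \<nu> B * \<nu> v"
    using op_norm_bound[OF nu, of B v] vector_norm_nonneg[OF nu, of "B *v v"] by linarith
  ultimately show ?thesis by (simp add: zero_le_mult_iff)
qed

lemma op_norm_pos:
  fixes B :: "complex^'n^'n"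
  assumes nu: "vector_norm \<nu>" and "invertible B"
  shows "0 < op_norm \<nu> B"
proof (rule ccontr)
  assume "\<not> 0 < op_norm \<nu> B"
  then have "op_norm \<nu> B = 0" using op_norm_nonneg[OF nu, of B] by simp
  then have "B *v v = 0" for v
    using op_norm_bound[OF nu, of B v] vector_norm_nonneg[OF nu, of "B *v v"]
      vector_norm_eq_0_iff[OF nu, of "B *v v"] by simp
  then have "v = 0" for v :: "complex^'n" using matrix_inv_vector(2)[OF assms(2), of v] by simp
  then show False by (metis axis_eq_0_iff zero_neq_one)
qed

subsection \<open>Eigenvalues\<close>

text \<open>A root \<open>\<mu>\<close> of the minimal polynomial \<open>[:- \<mu>, 1:] * q\<close> of a vector \<open>w\<close> with respect to
  \<open>B\<close> is an eigenvalue, with eigenvector \<open>q(B) w\<close>.\<close>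

lemma complex_matrix_eigenvalue_exists:
  fixes B :: "complex^'n^'n"
  shows "\<exists>\<mu> v. v \<noteq> 0 \<and> B *v v = \<mu> *s v"
proof -
  define w where "w = (axis undefined 1 :: complex^'n)"
  have w: "w \<noteq> 0" by (simp add: w_def axis_eq_0_iff)
  \<comment> \<open>The vectors \<open>T i\<close> are the Krylov vectors B^i w, so that
    \<open>ev p\<close> is p(B) w.\<close>
  define T where "T i = (((*v) B) ^^ i) w" for i
  define ev where "ev p = (\<Sum>i\<le>degree p. coeff p i *s T i)" for p :: "complex poly"
  have ev: "ev p = (\<Sum>i\<le>n. coeff p i *s T i)" if "degree p \<le> n" for p n
    unfolding ev_def using that
    by (intro sum.mono_neutral_left) (auto simp: coeff_eq_0)
  \<comment> \<open>The first n + 1 Krylov vectors are linearly dependent. The dependence lemma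
    speaks of a set and therefore needs them to be distinct; if two of them coincide, X^i - X^j
    annihilates \<open>w\<close> directly.\<close>
  have ex: "\<exists>p. p \<noteq> 0 \<and> ev p = 0"
  proof (cases "inj_on T {..CARD('n)}")
    case True
    have "vec.dependent (T ` {..CARD('n)})"
    proof (rule vec.dependent_biggerset_general)
      have "card (T ` {..CARD('n)}) = Suc CARD('n)" using card_image[OF True] by simp
      moreover have "vec.dim (T ` {..CARD('n)}) \<le> CARD('n)"
        using vec.dim_subset[of "T ` {..CARD('n)}" UNIV] by (simp only: vec_dim_card subset_UNIV simp_thms)
      ultimately show "card (T ` {..CARD('n)}) > vec.dim (T ` {..CARD('n)})" by simp
    qed
    then obtain c v where c: "v \<in> T ` {..CARD('n)}" "c v \<noteq> 0"
        "(\<Sum>v\<in>T ` {..CARD('n)}. c v *s v) = 0"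
      by (subst (asm) vec.dependent_finite) auto
    then obtain j where j: "j \<le> CARD('n)" "c (T j) \<noteq> 0" by auto
    define p where "p = (\<Sum>i\<le>CARD('n). monom (c (T i)) i)"
    have coeff_p: "coeff p i = (if i \<le> CARD('n) then c (T i) else 0)" for i
      by (simp add: p_def coeff_sum)
    have "p \<noteq> 0" using coeff_p[of j] j by auto
    moreover have "degree p \<le> CARD('n)" by (rule degree_le) (simp add: coeff_p)
    then have "ev p = (\<Sum>i\<le>CARD('n). c (T i) *s T i)" by (simp add: ev coeff_p)
    then have "ev p = 0" using c(3) by (simp add: sum.reindex[OF True])
    ultimately show ?thesis by blast
  next
    case False
    then obtain i j where ij: "i \<noteq> j" "T i = T j" by (auto simp: inj_on_def)
    define p where "p = monom (1::complex) i - monom 1 j"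
    have coeff_p: "coeff p k = (if k = i then 1 else 0) - (if k = j then 1 else 0)" for k
      by (auto simp: p_def)
    have "p \<noteq> 0" using coeff_p[of i] ij by auto
    moreover have "degree p \<le> i + j" by (rule degree_le) (auto simp: coeff_p)
    then have "ev p = (\<Sum>k\<le>i+j. (if k = i then T k else 0) - (if k = j then T k else 0))"
      unfolding ev[OF \<open>degree p \<le> i + j\<close>] by (intro sum.cong) (auto simp: coeff_p)
    then have "ev p = 0" using ij(2) by (simp add: sum_subtractf)
    ultimately show ?thesis by blast
  qed
  obtain p where p: "p \<noteq> 0" "ev p = 0" and
      minimal: "\<And>q. q \<noteq> 0 \<Longrightarrow> ev q = 0 \<Longrightarrow> degree p \<le> degree q"
    using ex_has_least_nat[of "\<lambda>p. p \<noteq> 0 \<and> ev p = 0" _ degree] ex by blast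
  have "\<not> constant (poly p)"
  proof
    assume "constant (poly p)"
    then have deg: "degree p = 0" by (simp add: constant_degree)
    then have "ev p = coeff p 0 *s w" by (simp add: ev_def T_def)
    moreover have "coeff p 0 \<noteq> 0" using p(1) deg by (metis leading_coeff_0_iff)
    ultimately show False using p(2) w by simp
  qed
  then obtain \<mu> where "poly p \<mu> = 0" using fundamental_theorem_of_algebra by blast
  then obtain q where q: "p = [:- \<mu>, 1:] * q" by (auto simp: poly_eq_0_iff_dvd)
  then have "q \<noteq> 0" using p(1) by auto
  have "ev q \<noteq> 0"
  proof
    assume "ev q = 0"
    from minimal[OF \<open>q \<noteq> 0\<close> this] show False
      unfolding q using \<open>q \<noteq> 0\<close> by (subst (asm) degree_mult_eq) auto
  qed
  moreover have "B *v ev q = \<mu> *s ev q"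
  proof -
    \<comment> \<open>Multiplication of \<open>q\<close> by X shifts its coefficients by one, which
      replaces \<open>T i\<close> by \<open>T (Suc i) = B *v T i\<close>. Hence p(B) w = B q(B) w -
      \<mu> q(B) w, and the left side is 0. All sums run up to \<open>Suc (degree q)\<close>, the
      degree of \<open>p\<close>.\<close>
    have coeff_p: "coeff p i = coeff (pCons 0 q) i - \<mu> * coeff q i" for i
      by (simp add: q)
    have "degree p = Suc (degree q)" unfolding q using \<open>q \<noteq> 0\<close> by (subst degree_mult_eq) auto
    then have "ev p = (\<Sum>i\<le>Suc (degree q). (coeff (pCons 0 q) i - \<mu> * coeff q i) *s T i)"
      by (simp add: ev_def coeff_p del: sum.atMost_Suc)
    also have "\<dots> = (\<Sum>i\<le>Suc (degree q). coeff (pCons 0 q) i *s T i) - \<mu> *s ev q"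
      by (simp add: ev[of q "Suc (degree q)"] vec.scale_left_diff_distrib sum_subtractf
          vec.scale_sum_right vec.scale_scale del: sum.atMost_Suc coeff_pCons)
    also have "(\<Sum>i\<le>Suc (degree q). coeff (pCons 0 q) i *s T i)
        = (\<Sum>i\<le>degree q. coeff q i *s T (Suc i))"
      by (subst sum.atMost_Suc_shift) simp
    also have "\<dots> = B *v ev q"
      by (simp add: ev_def T_def matrix_vector_scalar matrix_vector_sum)
    finally show ?thesis using p(2) by simp
  qed
  ultimately show ?thesis by blast
qed

text \<open>The set under \<open>Sup\<close> is bounded because an eigenvalue has modulus at most
  the operator norm. The norm \<open>\<nu>\<close> serves only to provide this bound.\<close>

lemma eigenvalue_le_spectral_radius:
  fixes B :: "complex^'n^'n"
  assumes nu: "vector_norm (\<nu> :: complex^'n \<Rightarrow> real)" and v: "v \<noteq> 0" "B *v v = \<mu> *s v"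
  shows "cmod \<mu> \<le> spectral_radius B"
  unfolding spectral_radius_def
proof (rule cSup_upper)
  show "cmod \<mu> \<in> {cmod \<mu> |\<mu>. \<exists>v. v \<noteq> 0 \<and> B *v v = \<mu> *s v}" using v by blast
  show "bdd_above {cmod \<mu> |\<mu>. \<exists>v. v \<noteq> 0 \<and> B *v v = \<mu> *s v}"
  proof (rule bdd_aboveI)
    fix r assume "r \<in> {cmod \<mu> |\<mu>. \<exists>v. v \<noteq> 0 \<and> B *v v = \<mu> *s v}"
    then obtain \<mu> v where v: "r = cmod \<mu>" "v \<noteq> 0" "B *v v = \<mu> *s v" by blast
    then have "r * \<nu> v \<le> op_norm \<nu> B * \<nu> v"
      using op_norm_bound[OF nu, of B v] by (simp add: vector_norm_scalar[OF nu])
    moreover have "\<nu> v > 0"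
      using v vector_norm_nonneg[OF nu, of v] vector_norm_eq_0_iff[OF nu, of v] by (auto simp: less_le)
    ultimately show "r \<le> op_norm \<nu> B" by simp
  qed
qed


section \<open>Operator norms of sums and of shifted matrices\<close>

lemma op_norm_add:
  assumes nu: "vector_norm \<nu>"
  shows "op_norm \<nu> (B + C) \<le> op_norm \<nu> B + op_norm \<nu> C"
proof (rule op_norm_least[OF nu])
  fix v
  have "\<nu> ((B + C) *v v) \<le> \<nu> (B *v v) + \<nu> (C *v v)"
    by (simp add: matrix_vector_simps vector_norm_add[OF nu])
  then show "\<nu> ((B + C) *v v) \<le> (op_norm \<nu> B + op_norm \<nu> C) * \<nu> v"
    using op_norm_bound[OF nu, of B v] op_norm_bound[OF nu, of C v] by (simp add: algebra_simps)
qed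

lemma op_norm_le_shifted:
  assumes nu: "vector_norm \<nu>" and "0 < \<alpha>"
  shows "op_norm \<nu> B \<le> op_norm \<nu> (shifted \<alpha> B) + \<alpha>"
proof (rule op_norm_least[OF nu])
  fix v
  have "\<nu> (B *v v) \<le> \<nu> (shifted \<alpha> B *v v) + \<nu> (\<alpha> *\<^sub>R v)"
    using vector_norm_diff[OF nu, of "shifted \<alpha> B *v v" "\<alpha> *\<^sub>R v"] by (simp add: shifted_vector)
  then show "\<nu> (B *v v) \<le> (op_norm \<nu> (shifted \<alpha> B) + \<alpha>) * \<nu> v"
    using op_norm_bound[OF nu, of "shifted \<alpha> B" v] \<open>0 < \<alpha>\<close>
    by (simp add: vector_norm_scaleR[OF nu] algebra_simps)
qed

subsection \<open>The GADI iteration matrix\<close>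

text \<open>With H = \<alpha> I + M and S = \<alpha> I + N one has H S = \<alpha>^2 I + \<alpha> (M
  + N) + M N. So the last factor of T is H S - (2 - \<omega>) \<alpha> (M + N), and multiplication
  by the two inverses leaves the identity minus a correction.\<close>

lemma gadi_T_vector:
  assumes "invertible (shifted \<alpha> M)" "invertible (shifted \<alpha> N)"
  shows "gadi_T M N \<alpha> \<omega> *v v =
    v - ((2 - \<omega>) * \<alpha>) *\<^sub>R
      (matrix_inv (shifted \<alpha> N) *v (matrix_inv (shifted \<alpha> M) *v ((M + N) *v v)))"
proof -
  have "(\<alpha>\<^sup>2 *\<^sub>R mat 1 + M ** N - ((1 - \<omega>) * \<alpha>) *\<^sub>R (M + N)) *v v
      = shifted \<alpha> M *v (shifted \<alpha> N *v v) - ((2 - \<omega>) * \<alpha>) *\<^sub>R ((M + N) *v v)"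
    by (simp add: shifted_vector matrix_vector_simps vec_eq_iff)
      (simp add: scaleR_conv_of_real algebra_simps power2_eq_square)
  then show ?thesis
    unfolding gadi_T_def
    by (simp add: matrix_vector_mul_assoc[symmetric] matrix_vector_mult_diff_distrib
        matrix_vector_scaleR matrix_inv_vector[OF assms(1)] matrix_inv_vector[OF assms(2)])
qed

text \<open>For \<open>\<omega> = 0\<close> an eigenpair of the iteration matrix satisfies
  \<open>(\<alpha> I - M) (\<alpha> I - N) v = \<mu> H S v\<close>. Since \<open>\<alpha> I - M = 2 \<alpha> I - H\<close> and
  \<open>\<alpha> I - N = 2 \<alpha> I - S\<close>, norms of \<open>H\<close> and \<open>S\<close> both below \<open>\<alpha>\<close> would force \<open>cmod \<mu> > 1\<close>.\<close>

lemma gadi_convergent_shift_le: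
  fixes M N :: "complex^'n^'n"
  assumes nu: "vector_norm \<nu>" and conv: "gadi_convergent M N" and "0 < \<alpha>"
  shows "\<alpha> \<le> op_norm \<nu> (shifted \<alpha> M) \<or> \<alpha> \<le> op_norm \<nu> (shifted \<alpha> N)"
proof (rule ccontr)
  define H S where "H = shifted \<alpha> M" and "S = shifted \<alpha> N"
  assume "\<not> ?thesis"
  then have small: "op_norm \<nu> H < \<alpha>" "op_norm \<nu> S < \<alpha>" by (auto simp: H_def S_def)
  have inv: "invertible H" "invertible S" and rho: "spectral_radius (gadi_T M N \<alpha> 0) < 1"
    using conv[unfolded gadi_convergent_def, rule_format, of \<alpha> 0] \<open>0 < \<alpha>\<close>
    by (auto simp: H_def S_def)
  obtain \<mu> v where v: "v \<noteq> 0" "gadi_T M N \<alpha> 0 *v v = \<mu> *s v"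
    using complex_matrix_eigenvalue_exists by blast
  have mu: "cmod \<mu> < 1" using eigenvalue_le_spectral_radius[OF nu v] rho by simp
  have pos: "\<nu> v > 0"
    using v vector_norm_nonneg[OF nu, of v] vector_norm_eq_0_iff[OF nu, of v] by (auto simp: less_le)
  \<comment> \<open>The reverse triangle inequality. For an operator norm below \<alpha> it makes 2
    \<alpha> I - B expand every nonzero vector by a factor above \<alpha>.\<close>
  have expand: "(2 * \<alpha> - op_norm \<nu> B) * \<nu> w \<le> \<nu> ((2 * \<alpha>) *\<^sub>R w - B *v w)" for B w
    using vector_norm_add[OF nu, of "(2 * \<alpha>) *\<^sub>R w - B *v w" "B *v w"]
      op_norm_bound[OF nu, of B w] \<open>0 < \<alpha>\<close>
    by (simp add: vector_norm_scaleR[OF nu] algebra_simps)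
  define w where "w = (2 * \<alpha>) *\<^sub>R v - S *v v"
  have "H *v (S *v (\<mu> *s v)) = H *v (S *v v) - (2 * \<alpha>) *\<^sub>R ((M + N) *v v)"
    unfolding v(2)[symmetric] gadi_T_vector[OF inv[unfolded H_def S_def]]
    by (simp add: matrix_vector_mult_diff_distrib matrix_vector_scaleR
        matrix_inv_vector[OF inv(1)] matrix_inv_vector[OF inv(2)] flip: H_def S_def)
  also have "\<dots> = (2 * \<alpha>) *\<^sub>R w - H *v w"
    by (simp add: w_def H_def S_def shifted_vector matrix_vector_simps vec_eq_iff)
      (simp add: scaleR_conv_of_real algebra_simps)
  finally have eq: "\<mu> *s (H *v (S *v v)) = (2 * \<alpha>) *\<^sub>R w - H *v w"
    by (simp add: matrix_vector_scalar)
  \<comment> \<open>The vector (2 \<alpha> I - H) (2 \<alpha> I - S) v has norm at least \<alpha>^2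
    \<open>\<nu> v\<close>. As it equals \<mu> H S v, its norm is also strictly below \<alpha>^2
    \<open>\<nu> v\<close>, a contradiction.\<close>
  have "\<alpha> * \<alpha> * \<nu> v \<le> (2 * \<alpha> - op_norm \<nu> H) * ((2 * \<alpha> - op_norm \<nu> S) * \<nu> v)"
    unfolding mult.assoc using small \<open>0 < \<alpha>\<close> pos by (intro mult_mono) auto
  also have "\<dots> \<le> (2 * \<alpha> - op_norm \<nu> H) * \<nu> w"
    using small \<open>0 < \<alpha>\<close> expand[of S v] by (intro mult_left_mono) (auto simp: w_def)
  also have "\<dots> \<le> cmod \<mu> * \<nu> (H *v (S *v v))"
    using expand[of H w] by (simp flip: eq add: vector_norm_scalar[OF nu])
  also have "\<nu> (H *v (S *v v)) \<le> \<alpha> * (\<alpha> * \<nu> v)"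
  proof -
    have "\<nu> (H *v (S *v v)) \<le> \<alpha> * \<nu> (S *v v)"
      using small(1) op_norm_bound[OF nu, of H "S *v v"] vector_norm_nonneg[OF nu, of "S *v v"]
      by (smt (verit) mult_right_mono)
    moreover have "\<nu> (S *v v) \<le> \<alpha> * \<nu> v"
      using small(2) op_norm_bound[OF nu, of S v] pos by (smt (verit) mult_right_mono)
    ultimately show ?thesis using \<open>0 < \<alpha>\<close> by (smt (verit) mult_left_mono)
  qed
  then have "cmod \<mu> * \<nu> (H *v (S *v v)) \<le> cmod \<mu> * (\<alpha> * (\<alpha> * \<nu> v))"
    by (intro mult_left_mono) auto
  also have "\<dots> < 1 * (\<alpha> * (\<alpha> * \<nu> v))"
    using mu pos \<open>0 < \<alpha>\<close> by (intro mult_strict_right_mono) auto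
  finally show False by simp
qed

subsection \<open>Rounding errors\<close>

text \<open>Multiplying out (I + P) B^-1 (B + E) = I gives P = -(I + P) B^-1 E, and the norm of I +
  P is at most 2. This turns the mere bound 1 on P into one proportional to the backward
  error.\<close>

lemma perturbed_inverse_bound:
  fixes B E P :: "complex^'n^'n"
  assumes nu: "vector_norm \<nu>" and inv: "invertible B" "invertible (B + E)"
    and P: "matrix_inv (B + E) = (mat 1 + P) ** matrix_inv B" "op_norm \<nu> P < 1"
  shows "op_norm \<nu> P \<le> 2 * op_norm \<nu> (matrix_inv B) * op_norm \<nu> E"
proof (rule op_norm_least[OF nu])
  fix v
  define w where "w = matrix_inv B *v (E *v v)"
  have "v + P *v v = matrix_inv (B + E) *v ((B + E) *v v - E *v v)"
    unfolding P(1)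
    by (simp add: matrix_vector_mult_add_rdistrib matrix_inv_vector[OF inv(1)]
        flip: matrix_vector_mul_assoc)
  also have "\<dots> = v - matrix_inv (B + E) *v (E *v v)"
    by (simp only: matrix_vector_mult_diff_distrib matrix_inv_vector[OF inv(2)])
  finally have "P *v v = - (w + P *v w)"
    unfolding P(1) w_def
    by (simp add: matrix_vector_mult_add_rdistrib eq_neg_iff_add_eq_0 algebra_simps
        flip: matrix_vector_mul_assoc)
  then have "\<nu> (P *v v) \<le> \<nu> w + op_norm \<nu> P * \<nu> w"
    using vector_norm_add[OF nu, of w "P *v w"] op_norm_bound[OF nu, of P w]
    by (simp add: vector_norm_minus[OF nu] del: minus_add_distrib)
  also have "\<dots> \<le> 2 * \<nu> w"
    using P(2) vector_norm_nonneg[OF nu, of w] mult_right_mono[of "op_norm \<nu> P" 1 "\<nu> w"] by simp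
  also have "\<nu> w \<le> op_norm \<nu> (matrix_inv B) * (op_norm \<nu> E * \<nu> v)"
    unfolding w_def
    by (rule order_trans[OF op_norm_bound[OF nu] mult_left_mono[OF op_norm_bound[OF nu] op_norm_nonneg[OF nu]]])
  finally show "\<nu> (P *v v) \<le> 2 * op_norm \<nu> (matrix_inv B) * op_norm \<nu> E * \<nu> v"
    by (simp add: mult.assoc)
qed

text \<open>When the shift is dominated by the shifted matrix, the backward error is small relative
  to that matrix and not only to \<open>B\<close>.\<close>

lemma shifted_perturbation_small:
  fixes B E P :: "complex^'n^'n"
  assumes nu: "vector_norm \<nu>" and "0 < \<alpha>" "\<alpha> \<le> op_norm \<nu> (shifted \<alpha> B)"
    and inv: "invertible (shifted \<alpha> B)" "invertible (shifted \<alpha> B + E)"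
    and P: "matrix_inv (shifted \<alpha> B + E) = (mat 1 + P) ** matrix_inv (shifted \<alpha> B)"
      "op_norm \<nu> P < 1"
    and E: "op_norm \<nu> E \<le> f * w * op_norm \<nu> B" and "0 \<le> f" "0 \<le> w"
  shows "op_norm \<nu> P \<le> 4 * f * (cond_num \<nu> (shifted \<alpha> B) * w)"
proof -
  let ?B = "shifted \<alpha> B"
  have "op_norm \<nu> B \<le> 2 * op_norm \<nu> ?B"
    using op_norm_le_shifted[OF nu \<open>0 < \<alpha>\<close>, of B] assms(3) by simp
  then have "op_norm \<nu> E \<le> f * w * (2 * op_norm \<nu> ?B)"
    using E mult_left_mono[of "op_norm \<nu> B" "2 * op_norm \<nu> ?B" "f * w"] \<open>0 \<le> f\<close> \<open>0 \<le> w\<close>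
    by fastforce
  then have "2 * op_norm \<nu> (matrix_inv ?B) * op_norm \<nu> E
      \<le> 2 * op_norm \<nu> (matrix_inv ?B) * (f * w * (2 * op_norm \<nu> ?B))"
    by (intro mult_left_mono) (auto simp: op_norm_nonneg[OF nu])
  with perturbed_inverse_bound[OF nu inv P] show ?thesis
    by (simp add: cond_num_def mult_ac)
qed

text \<open>The norms of H and S cancel in \<open>kappa_hat\<close>, leaving the norms of the two
  inverses times \<alpha> (||H|| + ||S|| + 2 \<alpha>). The last sum bounds the norm of M + N = H +
  S - 2 \<alpha> I.\<close>

lemma kappa_hat_bound:
  assumes nu: "vector_norm \<nu>" and "0 < \<alpha>"
    and inv: "invertible (shifted \<alpha> M)" "invertible (shifted \<alpha> N)"
  shows "\<alpha> * op_norm \<nu> (matrix_inv (shifted \<alpha> N)) * op_norm \<nu> (matrix_inv (shifted \<alpha> M))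
      * op_norm \<nu> (M + N) \<le> kappa_hat \<nu> \<alpha> (shifted \<alpha> M) (shifted \<alpha> N)"
proof -
  define H S where "H = shifted \<alpha> M" and "S = shifted \<alpha> N"
  have "op_norm \<nu> (M + N) \<le> op_norm \<nu> H + op_norm \<nu> S + 2 * \<alpha>"
    using op_norm_add[OF nu, of M N] op_norm_le_shifted[OF nu \<open>0 < \<alpha>\<close>, of M]
      op_norm_le_shifted[OF nu \<open>0 < \<alpha>\<close>, of N] by (simp add: H_def S_def)
  then have "\<alpha> * op_norm \<nu> (matrix_inv S) * op_norm \<nu> (matrix_inv H) * op_norm \<nu> (M + N)
      \<le> \<alpha> * op_norm \<nu> (matrix_inv S) * op_norm \<nu> (matrix_inv H)
        * (op_norm \<nu> H + op_norm \<nu> S + 2 * \<alpha>)"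
    using \<open>0 < \<alpha>\<close> by (intro mult_left_mono) (auto simp: op_norm_nonneg[OF nu])
  also have "\<dots> = kappa_hat \<nu> \<alpha> H S"
    using op_norm_pos[OF nu inv(1)] op_norm_pos[OF nu inv(2)]
    by (simp add: kappa_hat_def cond_num_def H_def S_def field_simps power2_eq_square)
  finally show ?thesis by (simp add: H_def S_def)
qed


text \<open>One outer step, isolated from the iteration index and from the inner solves. The
  hypothesis \<open>amp\<close> sharpens the bound 4 + 4 f u, which \<open>JL\<close> alone would
  give, to 4 + 2 f u; the coefficient of the norm of x in \<open>beta_F\<close> requires exactly
  this.\<close>

lemma gadi_ir_step:
  fixes \<alpha> :: real and M N J L :: "complex^'n^'n" and x x0 x1 y r \<delta>r \<delta>x :: "complex^'n"
  defines "H \<equiv> shifted \<alpha> M" and "S \<equiv> shifted \<alpha> N" and "e \<equiv> x - x0"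
  assumes nu: "vector_norm \<nu>" and par: "0 < \<alpha>" "\<omega> < 2" "0 \<le> f" "0 < u" "0 < w" "0 < w'"
    and inv: "invertible H" "invertible S"
    and r: "r = (M + N) *v e + \<delta>r"
    and dr: "\<nu> \<delta>r \<le> w * \<nu> ((M + N) *v e)
      + (1 + w) * w' * (op_norm \<nu> (M + N) * \<nu> x0 + \<nu> ((M + N) *v x))"
    and y: "y = ((2 - \<omega>) * \<alpha>) *\<^sub>R
      ((mat 1 + J) *v (matrix_inv S *v ((mat 1 + L) *v (matrix_inv H *v r))))"
    and x1: "x1 = x0 + y + \<delta>x" and dx: "\<nu> \<delta>x \<le> f * u * (\<nu> x0 + \<nu> y)"
    and JL: "op_norm \<nu> J < 1" "op_norm \<nu> L < 1"
    and amp: "(1 + op_norm \<nu> J) * (1 + op_norm \<nu> L) * (1 + f * u) \<le> 4 + 2 * (f * u)"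
    and contr: "\<nu> (gadi_T M N \<alpha> \<omega> *v e) \<le> lam * \<nu> e"
  shows "\<nu> (x - x1) \<le> alpha_F lam \<omega> (theta \<nu> J L) (kappa_hat \<nu> \<alpha> H S) f u w w' * \<nu> e
    + beta_F \<omega> (kappa_hat \<nu> \<alpha> H S) f u w w' * \<nu> x"
proof -
  \<comment> \<open>\<open>Q\<close> is the computed counterpart of S^-1 H^-1, and \<open>D\<close>
    is its deviation. The three summands of \<open>D\<close> match the three summands of
    \<open>theta\<close>.\<close>
  define Q where "Q v = (mat 1 + J) *v (matrix_inv S *v ((mat 1 + L) *v (matrix_inv H *v v)))" for v
  define D where "D v = matrix_inv S *v (L *v (matrix_inv H *v v))
    + (J *v (matrix_inv S *v (matrix_inv H *v v))
      + J *v (matrix_inv S *v (L *v (matrix_inv H *v v))))" for v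
  define s h j l a p where "s = op_norm \<nu> (matrix_inv S)" and "h = op_norm \<nu> (matrix_inv H)"
    and "j = op_norm \<nu> J" and "l = op_norm \<nu> L" and "a = op_norm \<nu> (M + N)"
    and "p = (2 - \<omega>) * \<alpha>"
  define \<theta> m where "\<theta> = theta \<nu> J L" and "m = 1 + \<theta>"
  define K where "K = (2 - \<omega>) * kappa_hat \<nu> \<alpha> H S"
  define g where "g = p * (s * h)"
  note nonneg = op_norm_nonneg[OF nu]
  have pos: "0 \<le> s" "0 \<le> h" "0 \<le> j" "0 \<le> l" "0 \<le> a" "0 \<le> p" "0 \<le> f * u"
    using nonneg par by (auto simp: s_def h_def j_def l_def a_def p_def)
  have theta: "\<theta> = j + l + j * l" by (simp add: \<theta>_def theta_def j_def l_def)
  have pos': "0 \<le> \<theta>" "0 \<le> m" "0 \<le> g" using pos by (simp_all add: m_def theta g_def)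
  have m: "m = (1 + j) * (1 + l)" by (simp add: m_def theta algebra_simps)
  have "(1 + j) * (1 + l) \<le> 2 * 2" using JL pos by (intro mult_mono) (auto simp: j_def l_def)
  then have m4: "m \<le> 4" by (simp add: m)
  have mamp: "m * (1 + f * u) \<le> 4 + 2 * (f * u)" using amp by (simp add: m j_def l_def)
  have bound: "\<nu> (B *v v) \<le> C * (c * \<nu> v')" if "\<nu> v \<le> c * \<nu> v'" "op_norm \<nu> B = C" for B C c v v'
    using op_norm_bound[OF nu, of B v] mult_left_mono[OF that(1) nonneg[of B]] that(2) by simp
  have hv: "\<nu> (matrix_inv H *v v) \<le> h * \<nu> v" for v
    unfolding h_def by (rule op_norm_bound[OF nu])
  have Lhv: "\<nu> (L *v (matrix_inv H *v v)) \<le> (l * h) * \<nu> v" for v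
    using bound[OF hv l_def[symmetric]] by (simp add: mult.assoc)
  have shv: "\<nu> (matrix_inv S *v (matrix_inv H *v v)) \<le> (s * h) * \<nu> v" for v
    using bound[OF hv s_def[symmetric]] by (simp add: mult.assoc)
  have sLhv: "\<nu> (matrix_inv S *v (L *v (matrix_inv H *v v))) \<le> (s * (l * h)) * \<nu> v" for v
    using bound[OF Lhv s_def[symmetric]] by (simp add: mult.assoc)
  have D: "\<nu> (D v) \<le> \<theta> * (s * h) * \<nu> v" for v
  proof -
    have "\<nu> (D v) \<le> \<nu> (matrix_inv S *v (L *v (matrix_inv H *v v)))
        + (\<nu> (J *v (matrix_inv S *v (matrix_inv H *v v)))
          + \<nu> (J *v (matrix_inv S *v (L *v (matrix_inv H *v v)))))"
      unfolding D_def by (intro order_trans[OF vector_norm_add[OF nu]] add_left_mono vector_norm_add[OF nu])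
    also have "\<dots> \<le> (s * (l * h)) * \<nu> v + (j * ((s * h) * \<nu> v) + j * ((s * (l * h)) * \<nu> v))"
      by (intro add_mono sLhv bound[OF shv j_def[symmetric]] bound[OF sLhv j_def[symmetric]])
    finally show ?thesis by (simp add: theta algebra_simps)
  qed
  have QD: "Q v = matrix_inv S *v (matrix_inv H *v v) + D v" for v
    by (simp add: Q_def D_def matrix_vector_simps)
  have Q: "\<nu> (Q v) \<le> m * (s * h) * \<nu> v" for v
    unfolding QD using vector_norm_add[OF nu, of "matrix_inv S *v (matrix_inv H *v v)" "D v"] shv[of v] D[of v]
    by (simp add: m_def algebra_simps)
  have Qadd: "Q (v + v') = Q v + Q v'" for v v' by (simp add: Q_def matrix_vector_right_distrib)
  have yQ: "y = p *\<^sub>R (Q ((M + N) *v e) + Q \<delta>r)"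
    by (simp only: y p_def r flip: Q_def Qadd)

  \<comment> \<open>\<open>R\<close> is chosen so that ||M + N|| \<open>R\<close> bounds the
    residual error. The 2 arises because the norm of \<open>x\<close> enters both through
    \<open>x0 = x - e\<close> and through the right-hand side (M + N) x.\<close>
  define R where "R = w * \<nu> e + (1 + w) * w' * (\<nu> e + 2 * \<nu> x)"
  have "0 \<le> R" using par vector_norm_nonneg[OF nu] by (auto simp: R_def)
  have ga: "g * a \<le> K"
    using mult_left_mono[OF kappa_hat_bound[OF nu par(1) inv[unfolded H_def S_def]], of "2 - \<omega>"] par(2)
    by (simp add: g_def K_def a_def s_def h_def p_def H_def S_def mult_ac)
  have "0 \<le> g * a" using pos pos' by simp
  with ga have "0 \<le> K" by linarith
  have Ae: "\<nu> ((M + N) *v e) \<le> a * \<nu> e" unfolding a_def by (rule op_norm_bound[OF nu])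
  have Ax: "\<nu> ((M + N) *v x) \<le> a * \<nu> x" unfolding a_def by (rule op_norm_bound[OF nu])
  have x0: "\<nu> x0 \<le> \<nu> x + \<nu> e" using vector_norm_diff[OF nu, of x e] by (simp add: e_def)
  have "\<nu> \<delta>r \<le> w * (a * \<nu> e) + (1 + w) * w' * (a * (\<nu> x + \<nu> e) + a * \<nu> x)"
    by (rule order_trans[OF dr[folded a_def]])
      (use par pos x0 Ae Ax in \<open>intro add_mono mult_left_mono; simp\<close>)
  also have "\<dots> = a * R" by (simp add: R_def algebra_simps)
  finally have dr': "\<nu> \<delta>r \<le> a * R" .
  have gdr: "g * \<nu> \<delta>r \<le> K * R"
    using mult_left_mono[OF dr' pos'(3)] mult_right_mono[OF ga \<open>0 \<le> R\<close>] by (simp add: mult.assoc)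
  have gAe: "g * \<nu> ((M + N) *v e) \<le> K * \<nu> e"
    using mult_left_mono[OF Ae pos'(3)] mult_right_mono[OF ga vector_norm_nonneg[OF nu, of e]]
    by (simp add: mult.assoc)
  have pD: "\<nu> (p *\<^sub>R D ((M + N) *v e)) \<le> \<theta> * (K * \<nu> e)"
    using mult_left_mono[OF D[of "(M + N) *v e"] pos(6)] mult_left_mono[OF gAe pos'(1)] pos(6)
    by (simp add: vector_norm_scaleR[OF nu] g_def mult_ac)
  have pQ1: "\<nu> (p *\<^sub>R Q ((M + N) *v e)) \<le> m * (K * \<nu> e)"
    using mult_left_mono[OF Q[of "(M + N) *v e"] pos(6)] mult_left_mono[OF gAe pos'(2)] pos(6)
    by (simp add: vector_norm_scaleR[OF nu] g_def mult_ac)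
  have pQ2: "\<nu> (p *\<^sub>R Q \<delta>r) \<le> m * (K * R)"
    using mult_left_mono[OF Q[of "\<delta>r"] pos(6)] mult_left_mono[OF gdr pos'(2)] pos(6)
    by (simp add: vector_norm_scaleR[OF nu] g_def mult_ac)
  have "\<nu> y \<le> m * (K * \<nu> e) + m * (K * R)"
    unfolding yQ scaleR_right_distrib
    by (rule order_trans[OF vector_norm_add[OF nu] add_mono[OF pQ1 pQ2]])
  then have "\<nu> x0 + \<nu> y \<le> (\<nu> x + \<nu> e) + (m * (K * \<nu> e) + m * (K * R))"
    using x0 by linarith
  then have dx': "\<nu> \<delta>x \<le> f * u * ((\<nu> x + \<nu> e) + (m * (K * \<nu> e) + m * (K * R)))"
    by (rule order_trans[OF dx mult_left_mono]) (use pos in simp)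

  have diff: "x - x1 = gadi_T M N \<alpha> \<omega> *v e - (p *\<^sub>R D ((M + N) *v e) + p *\<^sub>R Q \<delta>r + \<delta>x)"
    unfolding x1 yQ gadi_T_vector[OF inv[unfolded H_def S_def]] QD[of "(M + N) *v e"]
    by (simp add: p_def e_def scaleR_right_distrib flip: H_def S_def)
  have "\<nu> (x - x1) \<le> lam * \<nu> e + (\<theta> * (K * \<nu> e) + m * (K * R)
      + f * u * ((\<nu> x + \<nu> e) + (m * (K * \<nu> e) + m * (K * R))))"
    unfolding diff
    using vector_norm_diff[OF nu, of "gadi_T M N \<alpha> \<omega> *v e" "p *\<^sub>R D ((M + N) *v e) + p *\<^sub>R Q \<delta>r + \<delta>x"]
      vector_norm_add[OF nu, of "p *\<^sub>R D ((M + N) *v e) + p *\<^sub>R Q \<delta>r" \<delta>x]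
      vector_norm_add[OF nu, of "p *\<^sub>R D ((M + N) *v e)" "p *\<^sub>R Q \<delta>r"] contr pD pQ2 dx'
    by linarith
  \<comment> \<open>The terms are sorted by \<open>\<nu> e\<close> and \<open>\<nu> x\<close>. In
    the former \<open>m\<close> stands alone, so \<open>m4\<close> suffices; in the latter it comes
    with the factor 1 + f u, which is where \<open>mamp\<close> is applied.\<close>
  also have "\<dots> = lam * \<nu> e + \<theta> * (K * \<nu> e) + f * u * (\<nu> x + \<nu> e)
      + m * (K * ((w + (1 + w) * w' + f * u * ((1 + w) * (1 + w'))) * \<nu> e))
      + m * (1 + f * u) * (2 * (K * ((1 + w) * w' * \<nu> x)))"
    by (simp add: R_def algebra_simps)
  also have "\<dots> \<le> lam * \<nu> e + \<theta> * (K * \<nu> e) + f * u * (\<nu> x + \<nu> e)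
      + 4 * (K * ((w + (1 + w) * w' + f * u * ((1 + w) * (1 + w'))) * \<nu> e))
      + (4 + 2 * (f * u)) * (2 * (K * ((1 + w) * w' * \<nu> x)))"
    using par pos \<open>0 \<le> K\<close> vector_norm_nonneg[OF nu]
    by (intro add_mono mult_right_mono m4 mamp order_refl) auto
  also have "\<dots> = alpha_F lam \<omega> \<theta> (kappa_hat \<nu> \<alpha> H S) f u w w' * \<nu> e
      + beta_F \<omega> (kappa_hat \<nu> \<alpha> H S) f u w w' * \<nu> x"
    by (simp add: alpha_F_def beta_F_def K_def algebra_simps)
  finally show ?thesis unfolding \<theta>_def .
qed

section \<open>Choice of the smallness constant and the bound for every step\<close>

theorem theorem2p3:
  fixes phi varphi phi2 :: "nat \<Rightarrow> real"
  assumes "\<And>m. 0 \<le> phi m" and "\<And>m. 0 \<le> varphi m" and "\<And>m. 0 \<le> phi2 m"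
  shows "\<exists>c :: nat \<Rightarrow> real. (\<forall>m. 0 < c m) \<and>
    (\<forall>(\<nu> :: complex^'n \<Rightarrow> real) (A :: real^'n^'n) (AC :: complex^'n^'n) M N H S b x
        \<alpha> \<omega> u u\<^sub>r u\<^sub>f xh rh zh yh G F J L lam.
      vector_norm \<nu> \<and>
      invertible A \<and> AC = map_matrix complex_of_real A \<and> AC = M + N \<and> AC *v x = b \<and>
      0 < \<alpha> \<and> 0 \<le> \<omega> \<and> \<omega> < 2 \<and>
      H = shifted \<alpha> M \<and> S = shifted \<alpha> N \<and>
      gadi_convergent M N \<and>
      0 < u \<and> u < 1 \<and> 0 < u\<^sub>r \<and> u\<^sub>r < 1 \<and> 0 < u\<^sub>f \<and> u\<^sub>f < 1 \<and>
      rounded_iteration \<nu> (phi2 CARD('n)) u u\<^sub>r u\<^sub>f AC b xh rh yh \<and>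
      backward_stable_solves \<nu> (phi CARD('n)) (varphi CARD('n)) u\<^sub>r M N \<alpha> \<omega> rh zh yh G F \<and>
      c CARD('n) * cond_num \<nu> S * u\<^sub>r < 1/2 \<and> c CARD('n) * cond_num \<nu> H * u\<^sub>r < 1/2 \<and>
      perturbed_inverses \<nu> H S G F J L \<and>
      lam < 1
      \<longrightarrow> (\<forall>k. \<nu> (gadi_T M N \<alpha> \<omega> *v (x - xh k)) \<le> lam * \<nu> (x - xh k) \<longrightarrow>
            \<nu> (x - xh (Suc k))
              \<le> alpha_F lam \<omega> (theta \<nu> (J k) (L k)) (kappa_hat \<nu> \<alpha> H S)
                   (phi2 CARD('n)) u u\<^sub>r u\<^sub>f * \<nu> (x - xh k)
                + beta_F \<omega> (kappa_hat \<nu> \<alpha> H S) (phi2 CARD('n)) u u\<^sub>r u\<^sub>f * \<nu> x))"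
proof -
  \<comment> \<open>The sum 1 + phi + varphi serves both inner solves and keeps \<open>c\<close>
    positive, while 1 + phi2 absorbs the factor 1 + phi2 u. The leading 2 turns the constant 4 of
    the perturbation bound into 2 c z, which is below 1 once c z < 1/2.\<close>
  define c where "c m = 2 * (1 + phi m + varphi m) * (1 + phi2 m)" for m
  have c_pos: "0 < c m" for m
    unfolding c_def using assms[of m] by (intro mult_pos_pos add_pos_nonneg) auto
  have small: "t * (1 + phi2 m * u) \<le> 1"
    if t: "0 \<le> t" "t \<le> 4 * f * z" and f: "f \<le> phi m + varphi m" and z: "c m * z < 1/2" "0 \<le> z"
      and u: "u < 1" for t f z u :: real and m
  proof -
    have "t * (1 + phi2 m * u) \<le> t * (1 + phi2 m)"
      using t(1) u assms(3)[of m] mult_left_mono[of u 1 "phi2 m"] by (intro mult_left_mono) auto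
    also have "\<dots> \<le> 4 * (1 + phi m + varphi m) * z * (1 + phi2 m)"
      using t f z(2) assms(3)[of m] mult_right_mono[of f "1 + phi m + varphi m" z]
      by (intro mult_right_mono) (simp_all add: algebra_simps)
    also have "\<dots> = 2 * (c m * z)" by (simp add: c_def)
    finally show ?thesis using z(1) by linarith
  qed
  show ?thesis
  proof (intro exI[of _ c] conjI allI impI c_pos)
    fix \<nu> :: "complex^'n \<Rightarrow> real" and A :: "real^'n^'n" and AC M N H S :: "complex^'n^'n"
      and b x :: "complex^'n" and \<alpha> \<omega> u w w' lam :: real
      and xh rh zh yh :: "nat \<Rightarrow> complex^'n" and G F J L :: "nat \<Rightarrow> complex^'n^'n" and k
    assume hyp: "vector_norm \<nu> \<and>
      invertible A \<and> AC = map_matrix complex_of_real A \<and> AC = M + N \<and> AC *v x = b \<and>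
      0 < \<alpha> \<and> 0 \<le> \<omega> \<and> \<omega> < 2 \<and>
      H = shifted \<alpha> M \<and> S = shifted \<alpha> N \<and>
      gadi_convergent M N \<and>
      0 < u \<and> u < 1 \<and> 0 < w \<and> w < 1 \<and> 0 < w' \<and> w' < 1 \<and>
      rounded_iteration \<nu> (phi2 CARD('n)) u w w' AC b xh rh yh \<and>
      backward_stable_solves \<nu> (phi CARD('n)) (varphi CARD('n)) w M N \<alpha> \<omega> rh zh yh G F \<and>
      c CARD('n) * cond_num \<nu> S * w < 1/2 \<and> c CARD('n) * cond_num \<nu> H * w < 1/2 \<and>
      perturbed_inverses \<nu> H S G F J L \<and> lam < 1"
    assume contr: "\<nu> (gadi_T M N \<alpha> \<omega> *v (x - xh k)) \<le> lam * \<nu> (x - xh k)"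
    from hyp have nu: "vector_norm \<nu>" and AC: "AC = M + N" "AC *v x = b"
      and par: "0 < \<alpha>" "0 \<le> \<omega>" "\<omega> < 2" "0 < u" "u < 1" "0 < w" "0 < w'"
      and HS: "H = shifted \<alpha> M" "S = shifted \<alpha> N" and conv: "gadi_convergent M N"
      and iter: "rounded_iteration \<nu> (phi2 CARD('n)) u w w' AC b xh rh yh"
      and solves: "backward_stable_solves \<nu> (phi CARD('n)) (varphi CARD('n)) w M N \<alpha> \<omega> rh zh yh G F"
      and c: "c CARD('n) * cond_num \<nu> S * w < 1/2" "c CARD('n) * cond_num \<nu> H * w < 1/2"
      and pert: "perturbed_inverses \<nu> H S G F J L"
      by - ((elim conjE, assumption)+)
    have inv: "invertible H" "invertible S"
      using conv[unfolded gadi_convergent_def, rule_format, of \<alpha> \<omega>] par by (auto simp: HS)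
    have J: "invertible (S + F k)" "matrix_inv (S + F k) = (mat 1 + J k) ** matrix_inv S"
        "op_norm \<nu> (J k) < 1"
      and L: "invertible (H + G k)" "matrix_inv (H + G k) = (mat 1 + L k) ** matrix_inv H"
        "op_norm \<nu> (L k) < 1"
      using pert by (auto simp: perturbed_inverses_def)
    have solve: "(H + G k) *v zh k = rh k" "(S + F k) *v yh k = ((2 - \<omega>) * \<alpha>) *\<^sub>R zh k"
      and GF: "op_norm \<nu> (G k) \<le> phi CARD('n) * w * op_norm \<nu> M"
        "op_norm \<nu> (F k) \<le> varphi CARD('n) * w * op_norm \<nu> N"
      using solves by (auto simp: backward_stable_solves_def HS)
    obtain \<delta>r \<delta>x where step: "rh k = b - AC *v xh k + \<delta>r"
        "\<nu> \<delta>r \<le> w * \<nu> (b - AC *v xh k) + (1 + w) * w' * (op_norm \<nu> AC * \<nu> (xh k) + \<nu> b)"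
        "xh (Suc k) = xh k + yh k + \<delta>x"
        "\<nu> \<delta>x \<le> phi2 CARD('n) * u * (\<nu> (xh k) + \<nu> (yh k))"
      using iter unfolding rounded_iteration_def by blast
    have res: "b - AC *v xh k = (M + N) *v (x - xh k)" "b = (M + N) *v x"
      using AC by (auto simp: matrix_vector_mult_diff_distrib)
    have "zh k = matrix_inv (H + G k) *v rh k" "yh k = matrix_inv (S + F k) *v (((2 - \<omega>) * \<alpha>) *\<^sub>R zh k)"
      by (simp_all add: matrix_inv_vector(2)[OF L(1)] matrix_inv_vector(2)[OF J(1)]
          flip: solve)
    then have y: "yh k = ((2 - \<omega>) * \<alpha>) *\<^sub>R
        ((mat 1 + J k) *v (matrix_inv S *v ((mat 1 + L k) *v (matrix_inv H *v rh k))))"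
      by (simp add: J(2) L(2) matrix_vector_scaleR flip: matrix_vector_mul_assoc)
    have nonneg: "0 \<le> op_norm \<nu> (J k)" "0 \<le> op_norm \<nu> (L k)"
        "0 \<le> cond_num \<nu> S * w" "0 \<le> cond_num \<nu> H * w"
      using par by (auto simp: op_norm_nonneg[OF nu] cond_num_def)
    let ?j = "op_norm \<nu> (J k)" and ?l = "op_norm \<nu> (L k)" and ?f = "phi2 CARD('n) * u"
    have "0 \<le> ?f" using assms(3) par by simp
    have "\<alpha> \<le> op_norm \<nu> H \<or> \<alpha> \<le> op_norm \<nu> S"
      unfolding HS by (rule gadi_convergent_shift_le[OF nu conv par(1)])
    \<comment> \<open>Only the solve whose shifted matrix dominates \<alpha> yields a small
      perturbation, hence the disjunction.\<close>
    then have "?l * (1 + ?f) \<le> 1 \<or> ?j * (1 + ?f) \<le> 1"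
    proof
      assume "\<alpha> \<le> op_norm \<nu> H"
      then have "?l \<le> 4 * phi CARD('n) * (cond_num \<nu> H * w)"
        using shifted_perturbation_small[OF nu par(1) _ _ _ _ L(3) GF(1)] inv L assms par by (simp add: HS)
      then have "?l * (1 + ?f) \<le> 1"
        using small[OF nonneg(2) _ _ _ nonneg(4) par(5), of "phi CARD('n)" "CARD('n)"] c(2) assms
        by (simp add: mult.assoc)
      then show ?thesis ..
    next
      assume "\<alpha> \<le> op_norm \<nu> S"
      then have "?j \<le> 4 * varphi CARD('n) * (cond_num \<nu> S * w)"
        using shifted_perturbation_small[OF nu par(1) _ _ _ _ J(3) GF(2)] inv J assms par by (simp add: HS)
      then have "?j * (1 + ?f) \<le> 1"
        using small[OF nonneg(1) _ _ _ nonneg(3) par(5), of "varphi CARD('n)" "CARD('n)"] c(1) assms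
        by (simp add: mult.assoc)
      then show ?thesis ..
    qed
    \<comment> \<open>If \<open>?l * (1 + ?f) \<le> 1\<close>, then bounding \<open>1 + ?j\<close>
      by 2 leaves at most 2 ((1 + \<open>?f\<close>) + 1) = 4 + 2 \<open>?f\<close>. The other case
      is symmetric.\<close>
    then have amp: "(1 + ?j) * (1 + ?l) * (1 + ?f) \<le> 4 + 2 * ?f"
    proof
      assume l: "?l * (1 + ?f) \<le> 1"
      have "(1 + ?j) * ((1 + ?l) * (1 + ?f)) \<le> 2 * ((1 + ?l) * (1 + ?f))"
        using J(3) nonneg \<open>0 \<le> ?f\<close> by (intro mult_right_mono) auto
      with l show ?thesis by (simp add: algebra_simps)
    next
      assume j: "?j * (1 + ?f) \<le> 1"
      have "(1 + ?l) * ((1 + ?j) * (1 + ?f)) \<le> 2 * ((1 + ?j) * (1 + ?f))"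
        using L(3) nonneg \<open>0 \<le> ?f\<close> by (intro mult_right_mono) auto
      with j show ?thesis by (simp add: algebra_simps)
    qed
    show "\<nu> (x - xh (Suc k))
        \<le> alpha_F lam \<omega> (theta \<nu> (J k) (L k)) (kappa_hat \<nu> \<alpha> H S)
             (phi2 CARD('n)) u w w' * \<nu> (x - xh k)
          + beta_F \<omega> (kappa_hat \<nu> \<alpha> H S) (phi2 CARD('n)) u w w' * \<nu> x"
      using gadi_ir_step[OF nu par(1,3) assms(3) par(4,6,7) inv[unfolded HS]
          step(1)[unfolded res(1)] step(2)[unfolded res(1), unfolded res(2) AC(1)]
          y[unfolded HS] step(3,4) J(3) L(3) amp contr]
      by (simp add: HS)
  qed
qed

end
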